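(* For every integer $n\ge 1$ let $H=H^{(n)}\in C^2(\mathbb{R}^{n+1},\mathbb{R})$ with $\int_{\mathbb{R}^{n+1}}e^{-H(x)}dx<\infty$ and $\int_{\mathbb{R}^n}\exp\bigl(-H(x_1,\ldots,x_n,M-\sum_{i=1}^n x_i)\bigr)dx_1\cdots dx_n<\infty$ for every $M\in\mathbb{R}$. For every permutation $\pi$ of the $n+1$ coordinates and every $M\in\mathbb{R}$, let $\sigma_M^\pi$ be the probability measure on $\mathbb{R}^n$ with density with respect to Lebesgue measure proportional to $$\exp\Bigl(-(H\circ\pi)\bigl(x_1,\ldots,x_n,M-\sum_{i=1}^n x_i\bigr)\Bigr).$$ Suppose that there is a constant $\mathcal{P}>0$ (respectively $\mathcal{L}>0$), not depending on $n$, $M$ and $\pi$, such that $\sigma_M^\pi$ satisfies the Poincaré inequality with constant $\mathcal{P}$ (respectively the logarithmic Sobolev inequality with constant $\mathcal{L}$) for all $n$, $M$ and $\pi$. Let $\mu_M$ be the associated conditional probability measure on $\mathbb{R}^{n+1}$ given the sum of the coordinates equals $M$ (see context). Then for all $n\ge1$, all $M\in\mathbb{R}$ and every smooth $f:\mathbb{R}^{n+1}\to\mathbb{R}$, $$\mathbf{Var}_{\mu_M}(f)\le\frac{\mathcal{P}}{n+1}\,\mathbf{E}_{\mu_M}\Bigl(\sum_{1\le i,j\le n+1}|\partial_i f-\partial_j f|^2\Bigr),$$ and respectively $$\mathbf{Ent}_{\mu_M}(f^2)\le\frac{\mathcal{L}}{n+1}\,\mathbf{E}_{\mu_M}\Bigl(\sum_{1\le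 i,j\le n+1}|\partial_i f-\partial_j f|^2\Bigr).$$
   Context: For a probability measure $Q$: $\mathbf{E}_Q(f)=\int f\,dQ$; $\mathbf{Var}_Q(f)=\mathbf{E}_Q(f^2)-\mathbf{E}_Q(f)^2$; for nonnegative measurable $g$, $\mathbf{Ent}_Q(g)=\int g\log g\,dQ-\int g\,dQ\,\log\int g\,dQ$. $Q$ on $\mathbb{R}^n$ satisfies the Poincaré inequality with constant $\mathcal{P}$ if $\mathbf{Var}_Q(f)\le\mathcal{P}\,\mathbf{E}_Q(|\nabla f|^2)$ for every smooth $f:\mathbb{R}^n\to\mathbb{R}$, and the logarithmic Sobolev inequality with constant $\mathcal{L}$ if $\mathbf{Ent}_Q(f^2)\le\mathcal{L}\,\mathbf{E}_Q(|\nabla f|^2)$ for every smooth $f$, where $|\nabla f|^2=\sum_{i=1}^n|\partial_i f|^2$. Nothing is asserted when the right-hand side of an inequality is infinite. Let $\mu$ be the probability measure on $\mathbb{R}^{n+1}$ with density proportional to $e^{-H}$. The conditional measure is $\mu_M=\mu\bigl(\,\cdot\,\big|\,\sum_{i=1}^{n+1}x_i=M\bigr)$, given explicitly by $$\mathbf{E}_{\mu_M}(f)=\int_{\mathbb{R}^n}f\Bigl(x_1,\ldots,x_n,M-\sum_{i=1}^n x_i\Bigr)d\sigma_M(x_1,\ldots,x_n)$$ for bounded continuous $f$ on $\mathbb{R}^{n+1}$, where $\sigma_M=\sigma_M^{\mathrm{id}}$ is the probability measure on $\mathbb{R}^n$ with density proportional to $\exp(-H(x_1,\ldots,x_n,M-\sum_{i=1}^n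 x_i))$. *)

theory Defs
  imports "HOL-Probability.Probability"
begin

text \<open>
  The dimension varies inside the statement, so \<open>\<real>\<^sup>n\<close> is modelled by the extensional functions
  on \<open>{1..n}\<close>, with the topology inherited from the product topology on \<^typ>\<open>nat \<Rightarrow> real\<close>.
\<close>

definition Rn :: "nat \<Rightarrow> (nat \<Rightarrow> real) set" where
  "Rn n = PiE {1..n} (\<lambda>_. UNIV)"

definition leb :: "nat \<Rightarrow> (nat \<Rightarrow> real) measure" where
  "leb n = Pi\<^sub>M {1..n} (\<lambda>_. lborel)"

definition pderiv_at :: "nat \<Rightarrow> ((nat \<Rightarrow> real) \<Rightarrow> real) \<Rightarrow> (nat \<Rightarrow> real) \<Rightarrow> real" where
  "pderiv_at i f x = deriv (\<lambda>t. f (x(i := t))) (x i)"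

text \<open>\<open>C_diff k n f\<close>: on \<open>\<real>\<^sup>n\<close>, all partial derivatives of \<open>f\<close> of order at most \<open>k\<close> exist
  and are continuous.\<close>

primrec C_diff :: "nat \<Rightarrow> nat \<Rightarrow> ((nat \<Rightarrow> real) \<Rightarrow> real) \<Rightarrow> bool" where
  "C_diff 0 n f \<longleftrightarrow> continuous_on (Rn n) f"
| "C_diff (Suc k) n f \<longleftrightarrow> continuous_on (Rn n) f \<and>
     (\<forall>i\<in>{1..n}. (\<forall>x\<in>Rn n. (\<lambda>t. f (x(i := t))) field_differentiable at (x i)) \<and>
                  C_diff k n (pderiv_at i f))"

definition smooth :: "nat \<Rightarrow> ((nat \<Rightarrow> real) \<Rightarrow> real) \<Rightarrow> bool" where
  "smooth n f \<longleftrightarrow> (\<forall>k. C_diff k n f)"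

text \<open>
  Expectation of a nonnegative function, with values in \<open>[0, \<infinity>]\<close>. An inequality whose right-hand
  side is infinite therefore asserts nothing.
\<close>

definition nn_expect :: "'a measure \<Rightarrow> ('a \<Rightarrow> real) \<Rightarrow> ereal" where
  "nn_expect Q g = enn2ereal (\<integral>\<^sup>+x. ennreal (g x) \<partial>Q)"

text \<open>
  \<open>Var\<close> and \<open>Ent\<close> take the value \<open>\<infinity>\<close> when the integrals defining them are not finite. For a
  probability measure, integrability of \<open>f\<^sup>2\<close> implies that of \<open>f\<close>. For \<open>g \<ge> 0\<close>, since
  \<open>g log g\<close> is bounded below, a non-integrable \<open>g log g\<close> has integral \<open>\<infinity>\<close>, and an integrable
  one makes \<open>g\<close> integrable; \<open>0 * ln 0 = 0\<close> as usual.
\<close>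

definition Var :: "'a measure \<Rightarrow> ('a \<Rightarrow> real) \<Rightarrow> ereal" where
  "Var Q f = (if integrable Q (\<lambda>x. (f x)\<^sup>2)
              then ereal ((\<integral>x. (f x)\<^sup>2 \<partial>Q) - (\<integral>x. f x \<partial>Q)\<^sup>2) else \<infinity>)"

definition Ent :: "'a measure \<Rightarrow> ('a \<Rightarrow> real) \<Rightarrow> ereal" where
  "Ent Q g = (if integrable Q (\<lambda>x. g x * ln (g x))
              then ereal ((\<integral>x. g x * ln (g x) \<partial>Q) - (\<integral>x. g x \<partial>Q) * ln (\<integral>x. g x \<partial>Q))
              else \<infinity>)"

definition poincare :: "nat \<Rightarrow> (nat \<Rightarrow> real) measure \<Rightarrow> real \<Rightarrow> bool" where
  "poincare n Q P \<longleftrightarrow> (\<forall>f. smooth n f \<longrightarrow>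
     Var Q f \<le> ereal P * nn_expect Q (\<lambda>x. \<Sum>i=1..n. \<bar>pderiv_at i f x\<bar>\<^sup>2))"

definition log_sobolev :: "nat \<Rightarrow> (nat \<Rightarrow> real) measure \<Rightarrow> real \<Rightarrow> bool" where
  "log_sobolev n Q L \<longleftrightarrow> (\<forall>f. smooth n f \<longrightarrow>
     Ent Q (\<lambda>x. (f x)\<^sup>2) \<le> ereal L * nn_expect Q (\<lambda>x. \<Sum>i=1..n. \<bar>pderiv_at i f x\<bar>\<^sup>2))"

definition gibbs :: "nat \<Rightarrow> ((nat \<Rightarrow> real) \<Rightarrow> real) \<Rightarrow> (nat \<Rightarrow> real) measure" where
  "gibbs n V = density (leb n)
     (\<lambda>x. ennreal (exp (- V x)) / (\<integral>\<^sup>+y. ennreal (exp (- V y)) \<partial>leb n))"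

definition fill_last :: "nat \<Rightarrow> real \<Rightarrow> (nat \<Rightarrow> real) \<Rightarrow> (nat \<Rightarrow> real)" where
  "fill_last n M x = x(n + 1 := M - (\<Sum>i=1..n. x i))"

text \<open>A permutation \<open>\<pi>\<close> acts on \<open>\<real>\<^sup>n\<^sup>+\<^sup>1\<close> by \<open>x \<mapsto> (x\<^bsub>\<pi> 1\<^esub>, \<dots>, x\<^bsub>\<pi> (n+1)\<^esub>)\<close>, that is \<open>x \<circ> \<pi>\<close>.\<close>

definition sigma_perm ::
  "((nat \<Rightarrow> real) \<Rightarrow> real) \<Rightarrow> nat \<Rightarrow> real \<Rightarrow> (nat \<Rightarrow> nat) \<Rightarrow> (nat \<Rightarrow> real) measure" where
  "sigma_perm H n M \<pi> = gibbs n (\<lambda>x. H (fill_last n M x \<circ> \<pi>))"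

text \<open>The conditional measure \<open>\<mu>\<^sub>M\<close> as the image of \<open>\<sigma>\<^sub>M\<^sup>i\<^sup>d\<close>; see \<open>integral_mu_cond\<close> below for the
  defining formula.\<close>

definition mu_cond ::
  "((nat \<Rightarrow> real) \<Rightarrow> real) \<Rightarrow> nat \<Rightarrow> real \<Rightarrow> (nat \<Rightarrow> real) measure" where
  "mu_cond H n M = distr (sigma_perm H n M id) (leb (n + 1)) (fill_last n M)"

lemma space_leb: "space (leb n) = Rn n"
  by (simp add: leb_def Rn_def space_PiM)

lemma measurable_fill_last [measurable]: "fill_last n M \<in> leb n \<rightarrow>\<^sub>M leb (n + 1)"
proof -
  have eq: "{1..n + 1} = {1..n} \<union> {n + 1}" by auto
  have "(\<lambda>x. x(n + 1 := M - (\<Sum>i\<in>{1..n}. x i))) \<in>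
      Pi\<^sub>M {1..n} (\<lambda>_. lborel) \<rightarrow>\<^sub>M Pi\<^sub>M {1..n + 1} (\<lambda>_. lborel :: real measure)"
  proof (rule measurable_fun_upd[OF eq])
    show "(\<lambda>x. x) \<in> Pi\<^sub>M {1..n} (\<lambda>_. lborel) \<rightarrow>\<^sub>M Pi\<^sub>M {1..n} (\<lambda>_. lborel :: real measure)"
      by simp
    show "(\<lambda>x. M - (\<Sum>i\<in>{1..n}. x i)) \<in> Pi\<^sub>M {1..n} (\<lambda>_. lborel) \<rightarrow>\<^sub>M (lborel :: real measure)"
      by measurable
  qed
  then show ?thesis by (simp only: fill_last_def[abs_def] leb_def)
qed

lemma integral_mu_cond:
  fixes f :: "(nat \<Rightarrow> real) \<Rightarrow> real"
  assumes "f \<in> borel_measurable (leb (n + 1))"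
  shows "(\<integral>y. f y \<partial>mu_cond H n M) = (\<integral>x. f (fill_last n M x) \<partial>sigma_perm H n M id)"
  unfolding mu_cond_def
  by (rule integral_distr)
     (use assms measurable_fill_last in \<open>simp_all add: sigma_perm_def gibbs_def\<close>)

lemma prob_space_gibbs:
  assumes [measurable]: "V \<in> borel_measurable (leb n)"
    and fin: "(\<integral>\<^sup>+y. ennreal (exp (- V y)) \<partial>leb n) < \<infinity>"
  shows "prob_space (gibbs n V)"
proof
  let ?Z = "\<integral>\<^sup>+y. ennreal (exp (- V y)) \<partial>leb n"
  interpret product_sigma_finite "\<lambda>_::nat. lborel :: real measure" ..
  have "emeasure (leb n) (space (leb n)) = (\<Prod>i\<in>{1..n}. emeasure lborel (UNIV :: real set))"
    unfolding space_leb unfolding Rn_def leb_def by (rule emeasure_PiM) auto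
  also have "\<dots> \<noteq> 0" by simp
  finally have ne: "emeasure (leb n) (space (leb n)) \<noteq> 0" .
  have Z: "?Z \<noteq> 0"
  proof
    assume "?Z = 0"
    then have "AE x in leb n. False"
      by (subst (asm) nn_integral_0_iff_AE) (auto simp: ennreal_eq_0_iff not_le)
    then show False using ne by (simp add: AE_iff_null null_sets_def)
  qed
  have "emeasure (gibbs n V) (space (gibbs n V)) = (\<integral>\<^sup>+x. ennreal (exp (- V x)) / ?Z \<partial>leb n)"
    unfolding gibbs_def by (subst emeasure_density) (auto intro!: nn_integral_cong)
  also have "\<dots> = ?Z / ?Z" by (rule nn_integral_divide) measurable
  also have "\<dots> = 1" using Z fin by (simp add: ennreal_divide_self)
  finally show "emeasure (gibbs n V) (space (gibbs n V)) = 1" .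
qed

end

theory Submission
  imports Defs
begin

text \<open>
  Fix \<open>n\<close> and \<open>M\<close>. On the hyperplane of points with coordinate sum \<open>M\<close> any one of the \<open>n + 1\<close>
  coordinates may be eliminated in favour of the others. If \<open>\<pi>\<close> is the transposition of \<open>m\<close> and
  \<open>n + 1\<close>, then the measure \<open>\<sigma>\<^sub>M\<^sup>\<pi>\<close> is \<open>\<mu>\<^sub>M\<close> written in the chart that eliminates
  \<open>x\<^sub>m\<close>: the chart is \<open>swap_fill n M m\<close>, and \<open>distr_sigma_swap_fill\<close> says that it pushes
  \<open>\<sigma>\<^sub>M\<^sup>\<pi>\<close> forward to \<open>\<mu>\<^sub>M\<close> whatever \<open>m\<close> is. The reason is that changing
  from one chart to another is a reflection in a single variable, hence preserves Lebesgue measure.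

  In the chart that eliminates \<open>x\<^sub>m\<close>, a move in the direction of \<open>x\<^sub>k\<close> is compensated by the
  opposite move of \<open>x\<^sub>m\<close>, so the partial derivatives of \<open>f\<close> read in the chart are
  \<open>\<partial>\<^sub>k f - \<partial>\<^sub>m f\<close> for \<open>k \<noteq> m\<close>
  (\<open>sum_pderiv_swap_fill\<close>). The inequality assumed for \<open>\<sigma>\<^sub>M\<^sup>\<pi>\<close>, applied to \<open>f\<close> read in
  the chart, therefore bounds the variance of \<open>f\<close> under \<open>\<mu>\<^sub>M\<close> by \<open>P\<close> times the expectation of
  \<open>\<Sum>k\<le>n+1. \<bar>\<partial>\<^sub>k f - \<partial>\<^sub>m f\<bar>\<^sup>2\<close>,
  and likewise for the entropy. Averaging over the \<open>n + 1\<close> choices of \<open>m\<close> gives the result. The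
  argument does not see whether the left-hand side is a variance or an entropy, and
  \<open>average_over_charts\<close> carries it out for both at once.
\<close>

section \<open>Continuous functions are measurable\<close>

lemma leb_sets [measurable_cong]: "sets (leb n) = sets (Pi\<^sub>M {1..n} (\<lambda>_. lborel))"
  by (simp add: leb_def)

lemma measurable_leb_component [measurable]:
  "i \<in> {1..n} \<Longrightarrow> (\<lambda>x. x i) \<in> borel_measurable (leb n)"
  unfolding leb_def by measurable

text \<open>
  The Borel sets of \<^typ>\<open>nat \<Rightarrow> real\<close> are those of the full countable product, so a continuous
  function on \<open>Rn n\<close> is extended to that space by composing it with the retraction that resets
  the coordinates outside \<open>{1..n}\<close>.
\<close>

lemma borel_measurable_continuous_on_Rn:
  fixes f :: "(nat \<Rightarrow> real) \<Rightarrow> real"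
  assumes "continuous_on (Rn n) f"
  shows "f \<in> borel_measurable (leb n)"
proof -
  let ?r = "\<lambda>x::nat \<Rightarrow> real. restrict x {1..n}"
  have "continuous_on UNIV ?r"
  proof (rule continuous_on_coordinatewise_then_product)
    show "continuous_on UNIV (\<lambda>x. ?r x i)" for i
      by (cases "i \<in> {1..n}") (auto intro: continuous_on_product_then_coordinatewise continuous_on_id)
  qed
  then have "continuous_on UNIV (f \<circ> ?r)"
    by (intro continuous_on_compose continuous_on_subset[OF assms]) (auto simp: Rn_def)
  then have fr: "f \<circ> ?r \<in> borel_measurable (Pi\<^sub>M UNIV (\<lambda>_::nat. borel :: real measure))"
    using borel_measurable_continuous_onI measurable_cong_sets sets_PiM_equal_borel by blast
  have "(\<lambda>x. x) \<in> leb n \<rightarrow>\<^sub>M Pi\<^sub>M UNIV (\<lambda>_::nat. borel :: real measure)"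
  proof (rule measurable_PiM_single')
    show "(\<lambda>x. x i) \<in> borel_measurable (leb n)" for i
    proof (cases "i \<in> {1..n}")
      case False
      then have "(\<lambda>x. x i) \<in> borel_measurable (leb n) \<longleftrightarrow>
          (\<lambda>x. undefined :: real) \<in> borel_measurable (leb n)"
        by (intro measurable_cong) (auto simp: space_leb Rn_def PiE_def extensional_def)
      then show ?thesis by simp
    qed simp
  qed auto
  from measurable_compose[OF this fr] have "(\<lambda>x. f (?r x)) \<in> borel_measurable (leb n)"
    by simp
  also have "?this \<longleftrightarrow> f \<in> borel_measurable (leb n)"
    by (intro measurable_cong) (auto simp: space_leb Rn_def PiE_restrict)
  finally show ?thesis .
qed

section \<open>Differentiable functions on extensional tuples\<close>

lemma Rn_fun_upd: "x \<in> Rn n \<Longrightarrow> i \<in> {1..n} \<Longrightarrow> x(i := t) \<in> Rn n"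
  by (auto simp: Rn_def PiE_def extensional_def)

lemma C_diff_continuous: "C_diff k n f \<Longrightarrow> continuous_on (Rn n) f"
  by (cases k) auto

lemma pderiv_at_cong:
  assumes "\<And>x. x \<in> Rn n \<Longrightarrow> f x = g x" "x \<in> Rn n" "i \<in> {1..n}"
  shows "pderiv_at i f x = pderiv_at i g x"
  using assms by (simp add: pderiv_at_def Rn_fun_upd)

lemma C_diff_cong:
  assumes "\<And>x. x \<in> Rn n \<Longrightarrow> f x = g x"
  shows "C_diff k n f \<longleftrightarrow> C_diff k n g"
  using assms
proof (induction k arbitrary: f g)
  case 0
  then show ?case by (auto cong: continuous_on_cong)
next
  case (Suc k)
  have cont: "continuous_on (Rn n) f \<longleftrightarrow> continuous_on (Rn n) g"
    using Suc.prems by (auto cong: continuous_on_cong)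
  have line: "(\<lambda>t. f (x(i := t))) = (\<lambda>t. g (x(i := t)))"
    if "x \<in> Rn n" "i \<in> {1..n}" for x i
    by (intro ext Suc.prems Rn_fun_upd that)
  have pderiv: "C_diff k n (pderiv_at i f) \<longleftrightarrow> C_diff k n (pderiv_at i g)"
    if "i \<in> {1..n}" for i
    using that pderiv_at_cong Suc.prems by (intro Suc.IH) metis
  show ?case
    unfolding C_diff.simps
    by (intro conj_cong ball_cong refl cont pderiv) (simp_all only: line)
qed

lemma C_diff_DERIV:
  assumes "C_diff (Suc k) n f" "x \<in> Rn n" "i \<in> {1..n}"
  shows "((\<lambda>s. f (x(i := s))) has_real_derivative pderiv_at i f (x(i := t))) (at t)"
proof -
  have "\<forall>z\<in>Rn n. (\<lambda>s. f (z(i := s))) field_differentiable at (z i)"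
    using assms by simp
  from bspec[OF this Rn_fun_upd[OF assms(2,3), of t]]
  have "(\<lambda>s. f ((x(i := t))(i := s))) field_differentiable at ((x(i := t)) i)" .
  then show ?thesis by (simp add: pderiv_at_def DERIV_deriv_iff_field_differentiable)
qed

text \<open>
  A closure property is proved by exhibiting the partial derivatives up to equality on \<open>Rn n\<close>;
  \<open>pderiv_at\<close> may take any value elsewhere.
\<close>

lemma C_diff_SucI:
  assumes "continuous_on (Rn n) f"
    and "\<And>i x. i \<in> {1..n} \<Longrightarrow> x \<in> Rn n \<Longrightarrow>
           ((\<lambda>t. f (x(i := t))) has_real_derivative f' i x) (at (x i))"
    and "\<And>i. i \<in> {1..n} \<Longrightarrow> C_diff k n (f' i)"
  shows "C_diff (Suc k) n f"
proof -
  have "pderiv_at i f x = f' i x" if "i \<in> {1..n}" "x \<in> Rn n" for i x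
    using assms(2)[OF that] by (simp add: pderiv_at_def DERIV_imp_deriv)
  then have "C_diff k n (pderiv_at i f)" if "i \<in> {1..n}" for i
    using that assms(3) C_diff_cong by metis
  with assms(1,2) show ?thesis
    unfolding C_diff.simps field_differentiable_def by blast
qed

lemma C_diff_diff:
  "C_diff k n f \<Longrightarrow> C_diff k n g \<Longrightarrow> C_diff k n (\<lambda>x. f x - g x)"
proof (induction k arbitrary: f g)
  case 0
  then show ?case by (auto intro: continuous_on_diff)
next
  case (Suc k)
  show ?case
  proof (rule C_diff_SucI)
    show "continuous_on (Rn n) (\<lambda>x. f x - g x)"
      using Suc.prems by (auto intro: continuous_on_diff)
  next
    fix i x assume ix: "i \<in> {1..n}" "x \<in> Rn n"
    show "((\<lambda>t. f (x(i := t)) - g (x(i := t))) has_real_derivative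
        pderiv_at i f x - pderiv_at i g x) (at (x i))"
      using C_diff_DERIV[OF Suc.prems(1) ix(2,1), of "x i"]
        C_diff_DERIV[OF Suc.prems(2) ix(2,1), of "x i"]
      by (intro DERIV_diff) (simp_all only: fun_upd_triv)
  next
    show "C_diff k n (\<lambda>x. pderiv_at i f x - pderiv_at i g x)" if "i \<in> {1..n}" for i
      using Suc.prems that by (intro Suc.IH) auto
  qed
qed

text \<open>
  The chain rule along a line on which one coordinate grows while another decreases. Existence of
  the partial derivatives would not be enough for it: their continuity is what makes \<open>f\<close>
  differentiable jointly in the two coordinates.
\<close>

lemma C_diff_DERIV_exchange:
  assumes f: "C_diff (Suc k) n f" and y: "y \<in> Rn n"
    and a: "a \<in> {1..n}" and b: "b \<in> {1..n}" and ab: "a \<noteq> b"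
  shows "((\<lambda>s. f (y(a := s, b := c - s))) has_real_derivative
      pderiv_at a f (y(a := t, b := c - t)) - pderiv_at b f (y(a := t, b := c - t))) (at t)"
proof -
  let ?z = "\<lambda>s u. y(a := s, b := u)"
  have z: "?z s u \<in> Rn n" for s u
    using y a b by (simp add: Rn_fun_upd)
  have fst_partial:
    "((\<lambda>s. f (?z s u)) has_derivative (\<lambda>h. pderiv_at a f (?z t u) * h)) (at t)" for u
    using C_diff_DERIV[OF f Rn_fun_upd[OF y b, of u] a, of t] ab
    by (simp add: has_field_derivative_def fun_upd_twist)
  have snd_partial:
    "((\<lambda>u. f (?z s u)) has_derivative blinfun_mult_right (pderiv_at b f (?z s u))) (at u)" for s u
    using C_diff_DERIV[OF f Rn_fun_upd[OF y a, of s] b, of u]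
    by (simp add: has_field_derivative_def)
  have z_cont: "continuous_on UNIV (\<lambda>p. ?z (fst p) (snd p))"
  proof (rule continuous_on_coordinatewise_then_product)
    show "continuous_on UNIV (\<lambda>p. ?z (fst p) (snd p) i)" for i
      by (cases "i = b"; cases "i = a") (auto intro!: continuous_intros)
  qed
  have "continuous_on (Rn n) (pderiv_at b f)"
    using f b by (auto intro: C_diff_continuous)
  from continuous_on_compose2[OF this z_cont]
  have "continuous_on UNIV (\<lambda>p. pderiv_at b f (?z (fst p) (snd p)))"
    using z by auto
  then have "continuous_on UNIV (\<lambda>p. blinfun_mult_right (pderiv_at b f (?z (fst p) (snd p))))"
    by (rule bounded_linear.continuous_on[OF bounded_linear_blinfun_mult_right])
  then have snd_cont: "continuous (at (t, c - t) within UNIV \<times> UNIV)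
      (\<lambda>(s, u). blinfun_mult_right (pderiv_at b f (?z s u)))"
    by (simp add: continuous_on_eq_continuous_at case_prod_beta')
  let ?w = "?z t (c - t)"
  have "((\<lambda>(s, u). f (?z s u)) has_derivative
      (\<lambda>(h, l). pderiv_at a f ?w * h + blinfun_mult_right (pderiv_at b f ?w) l))
      (at (t, c - t) within UNIV \<times> UNIV)"
    using fst_partial snd_partial snd_cont
    by (intro has_derivative_partialsI) (simp_all del: fun_upd_apply)
  note joint = this[unfolded UNIV_Times_UNIV]
  have line: "((\<lambda>s. (s, c - s)) has_derivative (\<lambda>h. (h, - h))) (at t)"
    by (auto intro!: derivative_eq_intros)
  have "((\<lambda>s. f (?z s (c - s))) has_derivative
      (\<lambda>h. pderiv_at a f ?w * h + pderiv_at b f ?w * - h)) (at t)"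
    using has_derivative_compose[OF line joint] by simp
  then show ?thesis
    unfolding has_field_derivative_def
    by (rule has_derivative_eq_rhs) (simp add: fun_eq_iff algebra_simps)
qed

section \<open>Charts of the hyperplane\<close>

text \<open>
  The point of the hyperplane of coordinate sum \<open>M\<close> in which \<open>x\<close> supplies every coordinate but the
  \<open>m\<close>-th. For \<open>m \<le> n\<close> the value \<open>x m\<close> is moved to the vacant last place.
\<close>

definition swap_fill :: "nat \<Rightarrow> real \<Rightarrow> nat \<Rightarrow> (nat \<Rightarrow> real) \<Rightarrow> nat \<Rightarrow> real" where
  "swap_fill n M m x = fill_last n M x \<circ> Transposition.transpose m (n + 1)"

lemma swap_fill_in_Rn:
  assumes "m \<in> {1..n + 1}" "x \<in> Rn n"
  shows "swap_fill n M m x \<in> Rn (n + 1)"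
  using assms
  by (auto simp: swap_fill_def fill_last_def Rn_def PiE_def extensional_def
      Transposition.transpose_def)

lemma continuous_on_swap_fill: "continuous_on S (swap_fill n M m)"
proof (rule continuous_on_coordinatewise_then_product)
  have "continuous_on S (\<lambda>x. fill_last n M x j)" for j
    by (cases "j = n + 1")
      (auto simp: fill_last_def intro!: continuous_intros
        intro: continuous_on_product_then_coordinatewise continuous_on_id)
  then show "continuous_on S (\<lambda>x. swap_fill n M m x i)" for i
    by (simp add: swap_fill_def)
qed

text \<open>Moving \<open>x\<^sub>i\<close> in the chart moves the coordinates \<open>\<pi> i\<close> and \<open>m\<close> in opposite directions.\<close>

lemma swap_fill_fun_upd:
  assumes "m \<in> {1..n + 1}" "i \<in> {1..n}"
  defines "k \<equiv> Transposition.transpose m (n + 1) i"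
  shows "swap_fill n M m (x(i := t)) =
      (swap_fill n M m x)(k := t, m := (M - (\<Sum>j\<in>{1..n} - {i}. x j)) - t)"
proof -
  have "(\<Sum>j=1..n. (x(i := t)) j) = t + (\<Sum>j\<in>{1..n} - {i}. x j)"
    using assms(2) by (subst sum.remove[of _ i]) (auto intro!: sum.cong)
  then show ?thesis
    using assms(1,2)
    by (auto simp: swap_fill_def fill_last_def fun_eq_iff k_def Transposition.transpose_def)
qed

lemma DERIV_swap_fill:
  assumes f: "C_diff (Suc l) (n + 1) f" and x: "x \<in> Rn n"
    and m: "m \<in> {1..n + 1}" and i: "i \<in> {1..n}"
  defines "k \<equiv> Transposition.transpose m (n + 1) i"
  shows "((\<lambda>t. f (swap_fill n M m (x(i := t)))) has_real_derivative
      pderiv_at k f (swap_fill n M m x) - pderiv_at m f (swap_fill n M m x)) (at (x i))"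
proof -
  have k: "k \<in> {1..n + 1}" "k \<noteq> m"
    using m i by (auto simp: k_def Transposition.transpose_def)
  define c where "c = M - (\<Sum>j\<in>{1..n} - {i}. x j)"
  have upd: "swap_fill n M m (x(i := t)) = (swap_fill n M m x)(k := t, m := c - t)" for t
    using swap_fill_fun_upd[OF m i] by (simp add: k_def c_def)
  show ?thesis
    using C_diff_DERIV_exchange[OF f swap_fill_in_Rn[OF m x] k(1) m k(2), of M c "x i"]
    by (simp flip: upd)
qed

lemma C_diff_swap_fill:
  assumes "m \<in> {1..n + 1}"
  shows "C_diff l (n + 1) f \<Longrightarrow> C_diff l n (\<lambda>x. f (swap_fill n M m x))"
proof (induction l arbitrary: f)
  case 0
  then show ?case
    using swap_fill_in_Rn[OF assms]
    by (auto intro: continuous_on_compose2[OF _ continuous_on_swap_fill])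
next
  case (Suc l)
  let ?\<pi> = "Transposition.transpose m (n + 1)"
  show ?case
  proof (rule C_diff_SucI)
    show "continuous_on (Rn n) (\<lambda>x. f (swap_fill n M m x))"
      using C_diff_continuous[OF Suc.prems] swap_fill_in_Rn[OF assms]
      by (auto intro: continuous_on_compose2[OF _ continuous_on_swap_fill])
  next
    fix i x assume "i \<in> {1..n}" "x \<in> Rn n"
    then show "((\<lambda>t. f (swap_fill n M m (x(i := t)))) has_real_derivative
        pderiv_at (?\<pi> i) f (swap_fill n M m x) - pderiv_at m f (swap_fill n M m x)) (at (x i))"
      using DERIV_swap_fill[OF Suc.prems _ assms] by blast
  next
    fix i assume "i \<in> {1..n}"
    then have "?\<pi> i \<in> {1..n + 1}"
      using assms by (auto simp: Transposition.transpose_def)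
    then show "C_diff l n
        (\<lambda>x. pderiv_at (?\<pi> i) f (swap_fill n M m x) - pderiv_at m f (swap_fill n M m x))"
      using Suc.prems assms by (intro C_diff_diff Suc.IH) auto
  qed
qed

lemma sum_pderiv_swap_fill:
  fixes M :: real
  assumes f: "C_diff (Suc l) (n + 1) f" and x: "x \<in> Rn n" and m: "m \<in> {1..n + 1}"
  defines "y \<equiv> swap_fill n M m x"
  shows "(\<Sum>i=1..n. \<bar>pderiv_at i (\<lambda>x. f (swap_fill n M m x)) x\<bar>\<^sup>2) =
      (\<Sum>j=1..n + 1. \<bar>pderiv_at m f y - pderiv_at j f y\<bar>\<^sup>2)"
proof -
  let ?\<pi> = "Transposition.transpose m (n + 1)"
  have "(\<Sum>i=1..n. \<bar>pderiv_at i (\<lambda>x. f (swap_fill n M m x)) x\<bar>\<^sup>2) =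
      (\<Sum>i=1..n. \<bar>pderiv_at m f y - pderiv_at (?\<pi> i) f y\<bar>\<^sup>2)"
    using DERIV_imp_deriv[OF DERIV_swap_fill[OF f x m]]
    by (intro sum.cong) (auto simp: pderiv_at_def[of _ "\<lambda>x. f (swap_fill n M m x)"] y_def
        power2_commute)
  also have "\<dots> = (\<Sum>j\<in>{1..n + 1} - {m}. \<bar>pderiv_at m f y - pderiv_at j f y\<bar>\<^sup>2)"
    using m
    by (intro sum.reindex_bij_witness[of _ ?\<pi> ?\<pi>]) (auto simp: Transposition.transpose_def)
  also have "\<dots> = (\<Sum>j=1..n + 1. \<bar>pderiv_at m f y - pderiv_at j f y\<bar>\<^sup>2)"
    using m by (subst (2) sum.remove[of _ m]) auto
  finally show ?thesis .
qed

section \<open>All charts carry the same measure\<close>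

text \<open>
  Once the other variables are frozen, the map is a reflection \<open>t \<mapsto> c - t\<close> of the \<open>m\<close>-th
  variable, so Fubini's theorem reduces the claim to one dimension.
\<close>

lemma distr_leb_reflect:
  fixes M :: real
  assumes m: "m \<in> {1..n}"
  defines "T \<equiv> (\<lambda>x::nat \<Rightarrow> real. x(m := M - (\<Sum>i=1..n. x i)))"
  shows "T \<in> leb n \<rightarrow>\<^sub>M leb n" and "distr (leb n) (leb n) T = leb n"
proof -
  interpret product_sigma_finite "\<lambda>_::nat. lborel :: real measure" ..
  define I where "I = {1..n} - {m}"
  have I: "finite I" "m \<notin> I" "insert m I = {1..n}"
    using m by (auto simp: I_def)
  have eq: "{1..n} = {1..n} \<union> {m}" using m by auto
  show T [measurable]: "T \<in> leb n \<rightarrow>\<^sub>M leb n"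
    unfolding T_def leb_def
    by (rule measurable_fun_upd[OF eq]) measurable
  have upd: "T (x(m := t)) = x(m := (M - (\<Sum>i\<in>I. x i)) - t)" for x t
  proof -
    have "(\<Sum>i=1..n. (x(m := t)) i) = t + (\<Sum>i\<in>I. x i)"
      unfolding I_def using m by (subst sum.remove[of _ m]) (auto intro!: sum.cong)
    then show ?thesis by (simp add: T_def diff_diff_eq add.commute del: fun_upd_apply)
  qed
  have fubini: "(\<integral>\<^sup>+x. h x \<partial>leb n) =
      (\<integral>\<^sup>+x. (\<integral>\<^sup>+t. h (x(m := t)) \<partial>lborel) \<partial>Pi\<^sub>M I (\<lambda>_. lborel))"
    if "h \<in> borel_measurable (leb n)" for h
    using product_nn_integral_insert[OF I(1,2), of h] that unfolding leb_def I(3) .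
  show "distr (leb n) (leb n) T = leb n"
  proof (rule measure_eqI)
    fix A assume "A \<in> sets (distr (leb n) (leb n) T)"
    then have A [measurable]: "A \<in> sets (leb n)" by simp
    have ins [measurable]: "(\<lambda>t. x(m := t)) \<in> borel \<rightarrow>\<^sub>M leb n" if "x \<in> space (Pi\<^sub>M I (\<lambda>_. lborel))" for x
      using measurable_component_update[OF that I(2)] by (simp add: leb_def I(3))
    have "emeasure (distr (leb n) (leb n) T) A = (\<integral>\<^sup>+x. indicator A (T x) \<partial>leb n)"
      by (subst nn_integral_distr[symmetric, of T "leb n" "leb n"]) auto
    also have "\<dots> = (\<integral>\<^sup>+x. (\<integral>\<^sup>+t. indicator A (T (x(m := t))) \<partial>lborel) \<partial>Pi\<^sub>M I (\<lambda>_. lborel))"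
      by (rule fubini[of "\<lambda>x. indicator A (T x)"]) measurable
    also have "\<dots> = (\<integral>\<^sup>+x. (\<integral>\<^sup>+t. indicator A (x(m := t)) \<partial>lborel) \<partial>Pi\<^sub>M I (\<lambda>_. lborel))"
    proof (rule nn_integral_cong)
      fix x assume x: "x \<in> space (Pi\<^sub>M I (\<lambda>_. lborel :: real measure))"
      note [measurable] = ins[OF x]
      show "(\<integral>\<^sup>+t. indicator A (T (x(m := t))) \<partial>lborel) =
          (\<integral>\<^sup>+t. indicator A (x(m := t)) \<partial>(lborel :: real measure))"
        using nn_integral_real_affine[of "\<lambda>t. indicator A (x(m := t))" "-1" "M - (\<Sum>i\<in>I. x i)"]
        by (simp add: upd)
    qed
    also have "\<dots> = (\<integral>\<^sup>+x. indicator A x \<partial>leb n)"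
      by (rule fubini[of "indicator A", symmetric]) measurable
    finally show "emeasure (distr (leb n) (leb n) T) A = emeasure (leb n) A" by simp
  qed simp
qed

lemma distr_gibbs:
  assumes T [measurable]: "T \<in> leb n \<rightarrow>\<^sub>M leb n" and inv: "distr (leb n) (leb n) T = leb n"
    and V [measurable]: "V \<in> borel_measurable (leb n)"
  shows "distr (gibbs n (\<lambda>x. V (T x))) (leb n) T = gibbs n V"
proof -
  have "(\<integral>\<^sup>+x. ennreal (exp (- V (T x))) \<partial>leb n) = (\<integral>\<^sup>+x. ennreal (exp (- V x)) \<partial>leb n)"
    by (subst (2) inv[symmetric]) (simp add: nn_integral_distr)
  then show ?thesis
    unfolding gibbs_def by (subst (3) inv[symmetric]) (simp add: density_distr)
qed

lemma swap_fill_reflect: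
  assumes "m \<in> {1..n}"
  shows "swap_fill n M m x = fill_last n M (x(m := M - (\<Sum>i=1..n. x i)))"
proof -
  have "(\<Sum>i=1..n. (x(m := M - (\<Sum>i=1..n. x i))) i) =
      M - (\<Sum>i=1..n. x i) + (\<Sum>i\<in>{1..n} - {m}. x i)"
    using assms by (subst sum.remove[of _ m]) (auto intro!: sum.cong)
  also have "\<dots> = M - x m"
    using assms sum.remove[of "{1..n}" m x] by simp
  finally show ?thesis
    using assms
    by (auto simp: swap_fill_def fill_last_def fun_eq_iff Transposition.transpose_def)
qed

lemma swap_fill_last: "swap_fill n M (n + 1) = fill_last n M"
  by (simp add: swap_fill_def fun_eq_iff)

lemma measurable_swap_fill [measurable]:
  assumes "m \<in> {1..n + 1}"
  shows "swap_fill n M m \<in> leb n \<rightarrow>\<^sub>M leb (n + 1)"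
proof (cases "m = n + 1")
  case True
  then show ?thesis by (simp only: swap_fill_last measurable_fill_last)
next
  case False
  then have m: "m \<in> {1..n}" using assms by auto
  show ?thesis
    using measurable_compose[OF distr_leb_reflect(1)[OF m] measurable_fill_last]
    by (simp add: swap_fill_reflect[OF m, abs_def])
qed

lemma sigma_perm_transpose:
  "sigma_perm H n M (Transposition.transpose m (n + 1)) = gibbs n (\<lambda>x. H (swap_fill n M m x))"
  by (simp add: sigma_perm_def swap_fill_def)

lemma distr_sigma_swap_fill:
  assumes H [measurable]: "H \<in> borel_measurable (leb (n + 1))" and m: "m \<in> {1..n + 1}"
  shows "distr (sigma_perm H n M (Transposition.transpose m (n + 1))) (leb (n + 1))
      (swap_fill n M m) = mu_cond H n M"
proof (cases "m = n + 1")
  case True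
  then show ?thesis
    by (simp only: mu_cond_def swap_fill_last Transposition.transpose_same)
next
  case False
  then have m: "m \<in> {1..n}" using m by auto
  let ?T = "\<lambda>x. x(m := M - (\<Sum>i=1..n. x i))"
  let ?V = "\<lambda>x. H (fill_last n M x)"
  note T [measurable] = distr_leb_reflect(1)[OF m, of M]
  have "distr (gibbs n (\<lambda>x. ?V (?T x))) (leb (n + 1)) (\<lambda>x. fill_last n M (?T x)) =
      distr (distr (gibbs n (\<lambda>x. ?V (?T x))) (leb n) ?T) (leb (n + 1)) (fill_last n M)"
    by (subst distr_distr)
      (use T measurable_fill_last in \<open>simp_all add: comp_def gibbs_def\<close>)
  also have "\<dots> = distr (gibbs n ?V) (leb (n + 1)) (fill_last n M)"
    using distr_gibbs[OF T distr_leb_reflect(2)[OF m, of M], of ?V] by simp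
  finally show ?thesis
    unfolding sigma_perm_transpose swap_fill_reflect[OF m, abs_def]
    by (simp add: mu_cond_def sigma_perm_def)
qed

section \<open>Transport and averaging\<close>

lemma Var_distr:
  assumes "T \<in> Q \<rightarrow>\<^sub>M N" "f \<in> borel_measurable N"
  shows "Var (distr Q N T) f = Var Q (\<lambda>x. f (T x))"
  using assms by (simp add: Var_def integral_distr integrable_distr_eq)

lemma Ent_distr:
  assumes "T \<in> Q \<rightarrow>\<^sub>M N" "g \<in> borel_measurable N"
  shows "Ent (distr Q N T) g = Ent Q (\<lambda>x. g (T x))"
  using assms by (simp add: Ent_def integral_distr integrable_distr_eq)

lemma nn_expect_distr:
  assumes "T \<in> Q \<rightarrow>\<^sub>M N" "g \<in> borel_measurable N"
  shows "nn_expect (distr Q N T) g = nn_expect Q (\<lambda>x. g (T x))"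
  using assms by (simp add: nn_expect_def nn_integral_distr)

text \<open>
  Bounding the average from below by the least term avoids dividing in the extended reals, where
  \<open>v\<close> might be infinite or negative.
\<close>

lemma le_average:
  fixes a :: "'i \<Rightarrow> ennreal" and v :: ereal
  assumes "finite I" "I \<noteq> {}" "P > 0"
    and v: "\<And>i. i \<in> I \<Longrightarrow> v \<le> ereal P * enn2ereal (a i)"
  shows "v \<le> ereal (P / card I) * enn2ereal (\<Sum>i\<in>I. a i)"
proof -
  obtain m where m: "m \<in> I" "\<And>i. i \<in> I \<Longrightarrow> a m \<le> a i"
    using ex_min_if_finite[of "a ` I"] assms(1,2) by (auto simp: not_less)
  have "card I > 0" using assms by (simp add: card_gt_0_iff)
  then have "ereal P * enn2ereal (a m) = ereal (P / card I) * enn2ereal (of_nat (card I) * a m)"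
    by (simp add: times_ennreal.rep_eq mult.assoc[symmetric])
  also have "\<dots> \<le> ereal (P / card I) * enn2ereal (\<Sum>i\<in>I. a i)"
    using sum_bounded_below[of I "a m" a] m(2) assms(3)
    by (intro ereal_mult_left_mono) (auto simp: less_eq_ennreal.rep_eq)
  finally show ?thesis using v[OF m(1)] by (rule order_trans[rotated])
qed

text \<open>
  The value \<open>v\<close> stands for the variance of \<open>f\<close> or the entropy of \<open>f\<^sup>2\<close>, which by invariance
  under image measures is the same in every chart.
\<close>

lemma average_over_charts:
  assumes H: "continuous_on (Rn (n + 1)) H" and f: "smooth (n + 1) f" and "P > 0"
    and v: "\<And>m. m \<in> {1..n + 1} \<Longrightarrow>
      v \<le> ereal P * nn_expect (sigma_perm H n M (Transposition.transpose m (n + 1)))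
        (\<lambda>x. \<Sum>i=1..n. \<bar>pderiv_at i (\<lambda>x. f (swap_fill n M m x)) x\<bar>\<^sup>2)"
  shows "v \<le> ereal (P / (real n + 1)) * nn_expect (mu_cond H n M)
      (\<lambda>x. \<Sum>i=1..n + 1. \<Sum>j=1..n + 1. \<bar>pderiv_at i f x - pderiv_at j f x\<bar>\<^sup>2)"
proof -
  let ?\<mu> = "mu_cond H n M"
  define G where "G m y = (\<Sum>j=1..n + 1. \<bar>pderiv_at m f y - pderiv_at j f y\<bar>\<^sup>2)" for m y
  have C1: "C_diff (Suc 0) (n + 1) f"
    using f by (simp only: smooth_def)
  then have [measurable]: "pderiv_at i f \<in> borel_measurable (leb (n + 1))" if "i \<in> {1..n + 1}" for i
    using that by (intro borel_measurable_continuous_on_Rn) auto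
  have G [measurable]: "G m \<in> borel_measurable (leb (n + 1))" if "m \<in> {1..n + 1}" for m
    unfolding G_def using that by measurable
  have "v \<le> ereal P * enn2ereal (\<integral>\<^sup>+y. ennreal (G m y) \<partial>?\<mu>)" if m: "m \<in> {1..n + 1}" for m
  proof -
    let ?\<sigma> = "sigma_perm H n M (Transposition.transpose m (n + 1))"
    have S: "swap_fill n M m \<in> ?\<sigma> \<rightarrow>\<^sub>M leb (n + 1)"
      using measurable_swap_fill[OF m] by (simp add: sigma_perm_def gibbs_def)
    have "nn_expect ?\<sigma> (\<lambda>x. \<Sum>i=1..n. \<bar>pderiv_at i (\<lambda>x. f (swap_fill n M m x)) x\<bar>\<^sup>2) =
        nn_expect ?\<sigma> (\<lambda>x. G m (swap_fill n M m x))"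
      unfolding nn_expect_def G_def
      by (intro arg_cong[where f = enn2ereal] nn_integral_cong arg_cong[where f = ennreal]
          sum_pderiv_swap_fill[OF C1 _ m])
        (simp add: sigma_perm_def gibbs_def space_leb)
    also have "\<dots> = nn_expect ?\<mu> (G m)"
      using nn_expect_distr[OF S G[OF m]]
        distr_sigma_swap_fill[OF borel_measurable_continuous_on_Rn[OF H] m] by simp
    finally show ?thesis using v[OF m] by (simp add: nn_expect_def)
  qed
  then have "v \<le> ereal (P / card {1..n + 1}) *
      enn2ereal (\<Sum>m=1..n + 1. \<integral>\<^sup>+y. ennreal (G m y) \<partial>?\<mu>)"
    using \<open>P > 0\<close> by (intro le_average) auto
  also have "(\<Sum>m=1..n + 1. \<integral>\<^sup>+y. ennreal (G m y) \<partial>?\<mu>) =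
      (\<integral>\<^sup>+y. (\<Sum>m=1..n + 1. ennreal (G m y)) \<partial>?\<mu>)"
    using G by (intro nn_integral_sum[symmetric]) (auto simp: mu_cond_def)
  also have "\<dots> = (\<integral>\<^sup>+y. ennreal (\<Sum>m=1..n + 1. G m y) \<partial>?\<mu>)"
    by (intro nn_integral_cong sum_ennreal) (simp add: G_def sum_nonneg)
  finally show ?thesis by (simp add: nn_expect_def G_def add.commute)
qed

theorem proposition0p1:
  fixes H :: "nat \<Rightarrow> (nat \<Rightarrow> real) \<Rightarrow> real"
  assumes "\<And>n. n \<ge> 1 \<Longrightarrow> C_diff 2 (n + 1) (H n)"
    and "\<And>n. n \<ge> 1 \<Longrightarrow> (\<integral>\<^sup>+x. ennreal (exp (- H n x)) \<partial>leb (n + 1)) < \<infinity>"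
    and "\<And>n M. n \<ge> 1 \<Longrightarrow> (\<integral>\<^sup>+x. ennreal (exp (- H n (fill_last n M x))) \<partial>leb n) < \<infinity>"
  shows
    "(\<forall>P>0.
        (\<forall>n\<ge>1. \<forall>M. \<forall>\<pi>. \<pi> permutes {1..n + 1} \<longrightarrow> poincare n (sigma_perm (H n) n M \<pi>) P) \<longrightarrow>
        (\<forall>n\<ge>1. \<forall>M. \<forall>f. smooth (n + 1) f \<longrightarrow>
           Var (mu_cond (H n) n M) f
           \<le> ereal (P / (real n + 1)) *
             nn_expect (mu_cond (H n) n M)
               (\<lambda>x. \<Sum>i=1..n + 1. \<Sum>j=1..n + 1. \<bar>pderiv_at i f x - pderiv_at j f x\<bar>\<^sup>2)))
   \<and> (\<forall>L>0.
        (\<forall>n\<ge>1. \<forall>M. \<forall>\<pi>. \<pi> permutes {1..n + 1} \<longrightarrow> log_sobolev n (sigma_perm (H n) n M \<pi>) L) \<longrightarrow>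
        (\<forall>n\<ge>1. \<forall>M. \<forall>f. smooth (n + 1) f \<longrightarrow>
           Ent (mu_cond (H n) n M) (\<lambda>x. (f x)\<^sup>2)
           \<le> ereal (L / (real n + 1)) *
             nn_expect (mu_cond (H n) n M)
               (\<lambda>x. \<Sum>i=1..n + 1. \<Sum>j=1..n + 1. \<bar>pderiv_at i f x - pderiv_at j f x\<bar>\<^sup>2)))"
proof -
  have transp: "Transposition.transpose m (n + 1) permutes {1..n + 1}" if "m \<in> {1..n + 1}" for m n :: nat
    using that by (intro permutes_swap_id) simp_all
  have H_cont: "continuous_on (Rn (n + 1)) (H n)" if "n \<ge> 1" for n
    using assms(1)[OF that] by (rule C_diff_continuous)
  have smooth_chart: "smooth n (\<lambda>x. f (swap_fill n M m x))"
    if "smooth (n + 1) f" "m \<in> {1..n + 1}" for n M m f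
    using that C_diff_swap_fill by (auto simp: smooth_def)
  have f_meas: "f \<in> borel_measurable (leb (n + 1))" if "smooth (n + 1) f" for n f
    using that C_diff_continuous borel_measurable_continuous_on_Rn unfolding smooth_def by blast
  have chart_meas:
    "swap_fill n M m \<in> sigma_perm (H n) n M (Transposition.transpose m (n + 1)) \<rightarrow>\<^sub>M leb (n + 1)"
    if "m \<in> {1..n + 1}" for n M m
    using measurable_swap_fill[OF that] by (simp add: sigma_perm_def gibbs_def)
  have mu: "distr (sigma_perm (H n) n M (Transposition.transpose m (n + 1))) (leb (n + 1))
      (swap_fill n M m) = mu_cond (H n) n M"
    if "n \<ge> 1" "m \<in> {1..n + 1}" for n M m
    using that H_cont by (intro distr_sigma_swap_fill borel_measurable_continuous_on_Rn)
  show ?thesis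
  proof (intro conjI allI impI, goal_cases)
    case (1 P n M f)
    show ?case
    proof (rule average_over_charts[OF H_cont[OF \<open>n \<ge> 1\<close>] \<open>smooth (n + 1) f\<close> \<open>P > 0\<close>])
      fix m assume m: "m \<in> {1..n + 1}"
      let ?\<sigma> = "sigma_perm (H n) n M (Transposition.transpose m (n + 1))"
      have "Var (mu_cond (H n) n M) f = Var ?\<sigma> (\<lambda>x. f (swap_fill n M m x))"
        unfolding mu[OF \<open>n \<ge> 1\<close> m, symmetric]
        by (rule Var_distr[OF chart_meas[OF m] f_meas[OF \<open>smooth (n + 1) f\<close>]])
      moreover have "poincare n ?\<sigma> P"
        using 1 transp[OF m] by blast
      ultimately show "Var (mu_cond (H n) n M) f \<le> ereal P * nn_expect ?\<sigma>
          (\<lambda>x. \<Sum>i=1..n. \<bar>pderiv_at i (\<lambda>x. f (swap_fill n M m x)) x\<bar>\<^sup>2)"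
        using smooth_chart[OF _ m] 1 by (simp add: poincare_def)
    qed
  next
    case (2 L n M f)
    show ?case
    proof (rule average_over_charts[OF H_cont[OF \<open>n \<ge> 1\<close>] \<open>smooth (n + 1) f\<close> \<open>L > 0\<close>])
      fix m assume m: "m \<in> {1..n + 1}"
      let ?\<sigma> = "sigma_perm (H n) n M (Transposition.transpose m (n + 1))"
      have "(\<lambda>x. (f x)\<^sup>2) \<in> borel_measurable (leb (n + 1))"
        using f_meas 2 by (intro borel_measurable_power) blast
      then have "Ent (mu_cond (H n) n M) (\<lambda>x. (f x)\<^sup>2) = Ent ?\<sigma> (\<lambda>x. (f (swap_fill n M m x))\<^sup>2)"
        unfolding mu[OF \<open>n \<ge> 1\<close> m, symmetric] by (rule Ent_distr[OF chart_meas[OF m]])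
      moreover have "log_sobolev n ?\<sigma> L"
        using 2 transp[OF m] by blast
      ultimately show "Ent (mu_cond (H n) n M) (\<lambda>x. (f x)\<^sup>2) \<le> ereal L * nn_expect ?\<sigma>
          (\<lambda>x. \<Sum>i=1..n. \<bar>pderiv_at i (\<lambda>x. f (swap_fill n M m x)) x\<bar>\<^sup>2)"
        using smooth_chart[OF _ m] 2 by (simp add: log_sobolev_def)
    qed
  qed
qed

end
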